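(* Let $R$ be an infinite right homomorphically finite ring that has no zero divisors. Then there exists an ultrafilter $p\in\beta R$ such that every $A\in p$ is a central subset of $(R,+)$ and a central subset of $(R\setminus\{0\},\cdot)$.
   Context: Rings are associative, not necessarily commutative, and not required to have a multiplicative unit. A ring $R$ is right homomorphically finite if for every $r\in R\setminus\{0\}$ the right ideal $rR$ is a finite index subgroup of $(R,+)$. For a set $S$, $\beta S$ is the set of ultrafilters on $S$. For a semigroup $(S,\diamond)$, the operation extends to $\beta S$ by: $A\in p\diamond q$ iff $\{s\in S : s^{-1}A\in q\}\in p$, where $s^{-1}A=\{x\in S : s\diamond x\in A\}$; this makes $\beta S$ a compact right topological semigroup (topology with basis $\hat A=\{p\in\beta S : A\in p\}$, $A\subseteq S$), which has a smallest two-sided ideal $K(\beta S,\diamond)$. $E(K(\beta S,\diamond))$ is the set of idempotents in $K(\beta S,\diamond)$. A set $A\subseteq S$ is central in $(S,\diamond)$ if $A\in q$ for some $q\in E(K(\beta S,\diamond))$. Ultrafilters on $R\setminus\{0\}$ are identified with ultrafilters on $R$ other than the principal one at $0$; accordingly a set $A\subseteq R$ is called central in $(R\setminus\{0\},\cdot)$ if $A\setminus\{0\}$ is. *)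

theory Defs
  imports Main
begin

text \<open>
  An ultrafilter on \<open>S\<close> is a proper filter that contains \<open>S\<close> and decides every predicate.
  Filters are the library's, so \<open>A \<in> p\<close> is rendered as \<open>eventually (\<lambda>x. x \<in> A) p\<close>, and
  \<open>S \<in> p\<close> is \<open>p \<le> principal S\<close>.  The set \<open>\<beta>S\<close> is thereby realised inside \<open>\<beta>R\<close> for
  \<open>S \<subseteq> R\<close>, where \<open>R\<close> is the whole type.
\<close>

definition ultrafilters :: "'a set \<Rightarrow> 'a filter set" where
  "ultrafilters S =
     {p. p \<noteq> bot \<and> p \<le> principal S \<and> (\<forall>P. eventually P p \<or> eventually (\<lambda>x. \<not> P x) p)}"

lemma ultrafilters_minus_zero:
  "ultrafilters (UNIV - {0 :: 'a::zero}) = ultrafilters UNIV - {principal {0}}"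
proof -
  have "p \<le> principal (UNIV - {0}) \<longleftrightarrow> p \<noteq> principal {0}"
    if p: "p \<noteq> bot" and u: "\<forall>P. eventually P p \<or> eventually (\<lambda>x. \<not> P x) p" for p :: "'a filter"
  proof
    assume "p \<le> principal (UNIV - {0})"
    then show "p \<noteq> principal {0}"
      by (auto simp: le_principal eventually_principal)
  next
    assume ne: "p \<noteq> principal {0}"
    show "p \<le> principal (UNIV - {0})"
    proof (rule ccontr)
      assume "\<not> p \<le> principal (UNIV - {0})"
      then have 0: "eventually (\<lambda>x. x = 0) p"
        using u[rule_format, of "\<lambda>x. x = 0"] by (simp add: le_principal)
      have "eventually P p \<longleftrightarrow> P 0" for P
      proof
        assume "eventually P p"
        with 0 have "eventually (\<lambda>x. P 0) p" by eventually_elim simp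
        then show "P 0" using p by (metis eventually_const)
      next
        assume "P 0"
        then show "eventually P p" using 0 by (auto elim: eventually_mono)
      qed
      then have "p = principal {0}" by (simp add: filter_eq_iff eventually_principal)
      with ne show False ..
    qed
  qed
  then show ?thesis by (auto simp: ultrafilters_def)
qed

text \<open>The extension of a binary operation to ultrafilters.\<close>

definition ultra_op :: "('a \<Rightarrow> 'a \<Rightarrow> 'a) \<Rightarrow> 'a filter \<Rightarrow> 'a filter \<Rightarrow> 'a filter" where
  "ultra_op f p q = Abs_filter (\<lambda>P. \<forall>\<^sub>F s in p. \<forall>\<^sub>F x in q. P (f s x))"

lemma eventually_ultra_op:
  "eventually P (ultra_op f p q) \<longleftrightarrow> (\<forall>\<^sub>F s in p. \<forall>\<^sub>F x in q. P (f s x))"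
  unfolding ultra_op_def
proof (rule eventually_Abs_filter, rule is_filter.intro)
  show "\<forall>\<^sub>F s in p. \<forall>\<^sub>F x in q. True" by simp
next
  fix P Q
  assume "\<forall>\<^sub>F s in p. \<forall>\<^sub>F x in q. P (f s x)" "\<forall>\<^sub>F s in p. \<forall>\<^sub>F x in q. Q (f s x)"
  then show "\<forall>\<^sub>F s in p. \<forall>\<^sub>F x in q. P (f s x) \<and> Q (f s x)"
    by eventually_elim (rule eventually_conj)
next
  fix P Q :: "'a \<Rightarrow> bool"
  assume "\<forall>x. P x \<longrightarrow> Q x" "\<forall>\<^sub>F s in p. \<forall>\<^sub>F x in q. P (f s x)"
  then show "\<forall>\<^sub>F s in p. \<forall>\<^sub>F x in q. Q (f s x)"
    by (auto elim!: eventually_mono)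
qed

text \<open>On ultrafilters on \<open>S\<close> this is the usual definition via \<open>s\<^sup>-\<^sup>1A = {x \<in> S. f s x \<in> A}\<close>.\<close>

lemma mem_ultra_op:
  assumes "p \<in> ultrafilters S" "q \<in> ultrafilters S"
  shows "(\<forall>\<^sub>F x in ultra_op f p q. x \<in> A) \<longleftrightarrow>
         (\<forall>\<^sub>F s in p. s \<in> {s \<in> S. \<forall>\<^sub>F x in q. x \<in> {x \<in> S. f s x \<in> A}})"
  using assms by (simp add: eventually_ultra_op ultrafilters_def le_principal eventually_conj_iff)

lemma ultra_op_closed:
  assumes "\<And>x y. x \<in> S \<Longrightarrow> y \<in> S \<Longrightarrow> f x y \<in> S"
    and p: "p \<in> ultrafilters S" and q: "q \<in> ultrafilters S"
  shows "ultra_op f p q \<in> ultrafilters S"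
proof -
  have S: "eventually (\<lambda>x. x \<in> S) p" "eventually (\<lambda>x. x \<in> S) q"
    using p q by (auto simp: ultrafilters_def le_principal)
  have neg: "eventually (\<lambda>x. \<not> P x) r \<longleftrightarrow> \<not> eventually P r" if "r \<in> ultrafilters S" for r P
  proof
    assume n: "eventually (\<lambda>x. \<not> P x) r"
    show "\<not> eventually P r"
    proof
      assume "eventually P r"
      with n have "eventually (\<lambda>x. False) r" by eventually_elim simp
      with that show False by (simp add: ultrafilters_def trivial_limit_def)
    qed
  next
    assume "\<not> eventually P r"
    with that show "eventually (\<lambda>x. \<not> P x) r" by (auto simp: ultrafilters_def)
  qed
  have "\<forall>\<^sub>F s in p. \<forall>\<^sub>F x in q. f s x \<in> S"
    using S(1) by eventually_elim (use S(2) assms(1) in \<open>auto elim: eventually_mono\<close>)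
  moreover have "ultra_op f p q \<noteq> bot"
    using p q by (simp add: trivial_limit_def eventually_ultra_op ultrafilters_def)
  ultimately show ?thesis
    by (auto simp: ultrafilters_def le_principal eventually_ultra_op neg[OF p] neg[OF q])
qed

lemma ultra_op_assoc:
  assumes "\<And>x y z. x \<in> S \<Longrightarrow> y \<in> S \<Longrightarrow> z \<in> S \<Longrightarrow> f (f x y) z = f x (f y z)"
    and "p \<in> ultrafilters S" "q \<in> ultrafilters S" "r \<in> ultrafilters S"
  shows "ultra_op f (ultra_op f p q) r = ultra_op f p (ultra_op f q r)"
proof -
  have S: "eventually (\<lambda>x. x \<in> S) p" "eventually (\<lambda>x. x \<in> S) q" "eventually (\<lambda>x. x \<in> S) r"
    using assms by (auto simp: ultrafilters_def le_principal)
  have r: "(\<forall>\<^sub>F z in r. P (f (f x y) z)) \<longleftrightarrow> (\<forall>\<^sub>F z in r. P (f x (f y z)))"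
    if "x \<in> S" "y \<in> S" for x y P
    by (rule eventually_cong[OF S(3)]) (simp add: assms(1) that)
  have q: "(\<forall>\<^sub>F y in q. \<forall>\<^sub>F z in r. P (f (f x y) z)) \<longleftrightarrow>
        (\<forall>\<^sub>F y in q. \<forall>\<^sub>F z in r. P (f x (f y z)))" if "x \<in> S" for x P
    by (rule eventually_cong[OF S(2)]) (rule r[OF that])
  have "(\<forall>\<^sub>F x in p. \<forall>\<^sub>F y in q. \<forall>\<^sub>F z in r. P (f (f x y) z)) \<longleftrightarrow>
        (\<forall>\<^sub>F x in p. \<forall>\<^sub>F y in q. \<forall>\<^sub>F z in r. P (f x (f y z)))" for P
    by (rule eventually_cong[OF S(1)]) (rule q)
  then show ?thesis by (simp add: filter_eq_iff eventually_ultra_op)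
qed

definition two_sided_ideal :: "'a set \<Rightarrow> ('a \<Rightarrow> 'a \<Rightarrow> 'a) \<Rightarrow> 'a filter set \<Rightarrow> bool" where
  "two_sided_ideal S f I \<longleftrightarrow>
     I \<noteq> {} \<and> I \<subseteq> ultrafilters S \<and>
     (\<forall>p\<in>ultrafilters S. \<forall>q\<in>I. ultra_op f p q \<in> I \<and> ultra_op f q p \<in> I)"

text \<open>
  \<open>K(\<beta>S, f)\<close>: the least element, with respect to inclusion, among the two-sided ideals.
  It exists whenever \<open>(S, f)\<close> is a nonempty semigroup; otherwise the value is meaningless.
\<close>

definition smallest_ideal :: "'a set \<Rightarrow> ('a \<Rightarrow> 'a \<Rightarrow> 'a) \<Rightarrow> 'a filter set" where
  "smallest_ideal S f = (LEAST I. two_sided_ideal S f I)"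

definition central :: "'a set \<Rightarrow> ('a \<Rightarrow> 'a \<Rightarrow> 'a) \<Rightarrow> 'a set \<Rightarrow> bool" where
  "central S f A \<longleftrightarrow>
     A \<subseteq> S \<and> (\<exists>q\<in>smallest_ideal S f. ultra_op f q q = q \<and> (\<forall>\<^sub>F x in q. x \<in> A))"

definition finite_index_subgroup :: "'a::ab_group_add set \<Rightarrow> bool" where
  "finite_index_subgroup H \<longleftrightarrow>
     0 \<in> H \<and> (\<forall>x\<in>H. \<forall>y\<in>H. x - y \<in> H) \<and> finite (range (\<lambda>x. (+) x ` H))"

text \<open>The type class \<^class>\<open>ring\<close> requires neither commutativity nor a unit.\<close>

definition right_homomorphically_finite :: "'a::ring itself \<Rightarrow> bool" where
  "right_homomorphically_finite _ \<longleftrightarrow>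
     (\<forall>r::'a. r \<noteq> 0 \<longrightarrow> finite_index_subgroup (range (\<lambda>x. r * x)))"

end

theory Submission
  imports Defs
begin

text \<open>
  Write \<open>R\<close> for the ring and \<open>R* = R - {0}\<close>, and let \<open>L\<close> be the set of all ultrafilters on \<open>R*\<close> whose
  members are all additively central. The key point is that \<open>L\<close> is a left ideal of \<open>(\<beta>R*, \<cdot>)\<close>.
  In every compact right topological semigroup each left ideal contains an idempotent of the
  smallest ideal; such an idempotent \<open>p \<in> L\<close> of \<open>K(\<beta>R*, \<cdot>)\<close> is as required, since every \<open>A \<in> p\<close> is
  additively central by the definition of \<open>L\<close> and multiplicatively central because \<open>p\<close> witnesses it.

  That \<open>L\<close> is a left ideal means the following. If \<open>A \<in> p \<cdot> q\<close> with \<open>q \<in> L\<close>, then for some \<open>s \<noteq> 0\<close>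
  the set \<open>{x. s x \<in> A}\<close> belongs to \<open>q\<close>, so it is additively central, and \<open>A\<close> has to be so too.
  Left multiplication by \<open>s\<close> is an additive endomorphism \<open>h\<close>, and its extension \<open>\<beta>h\<close> to \<open>\<beta>R\<close> is
  an endomorphism of \<open>(\<beta>R, +)\<close> that carries idempotents to idempotents. It also maps \<open>K(\<beta>R, +)\<close>
  into itself (\<open>filtermap_smallest_ideal\<close>): the preimage of \<open>K(\<beta>R, +)\<close> under \<open>\<beta>h\<close> is a
  two-sided ideal as soon as it is nonempty, and then it contains the smallest one. Nonemptiness
  is where homomorphic finiteness enters: any ultrafilter in \<open>K(\<beta>R, +)\<close> concentrates on one of the
  finitely many cosets of \<open>s R\<close>, and translating it by an element of \<open>R\<close> moves it onto \<open>s R\<close>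
  without leaving \<open>K(\<beta>R, +)\<close>. Finally \<open>L\<close> is nonempty because \<open>R\<close> is infinite, which keeps the
  principal ultrafilter at \<open>0\<close> out of \<open>K(\<beta>R, +)\<close> (\<open>nonprincipal_two_sided_ideal\<close>).

  The general facts about \<open>\<beta>S\<close> are obtained for an arbitrary semigroup \<open>S\<close>, as they are applied to
  \<open>(R, +)\<close> as well as to \<open>(R*, \<cdot>)\<close>: compactness yields minimal closed left ideals, which
  give the smallest ideal, and minimal closed subsemigroups, which
  consist of idempotents (Ellis's theorem).
\<close>

section \<open>Ultrafilters\<close>

lemma Zorn_minimal:
  fixes \<A> :: "'a::complete_lattice set"
  assumes "\<A> \<noteq> {}"
    and chain: "\<And>C. C \<subseteq> \<A> \<Longrightarrow> C \<noteq> {} \<Longrightarrow> (\<And>x y. x \<in> C \<Longrightarrow> y \<in> C \<Longrightarrow> x \<le> y \<or> y \<le> x) \<Longrightarrow> Inf C \<in> \<A>"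
  obtains m where "m \<in> \<A>" "\<And>a. a \<in> \<A> \<Longrightarrow> a \<le> m \<Longrightarrow> a = m"
proof -
  have "\<exists>m\<in>\<A>. \<forall>a\<in>\<A>. a \<le> m \<longrightarrow> a = m"
  proof (rule predicate_Zorn)
    show "partial_order_on \<A> (relation_of (\<lambda>x y. y \<le> x) \<A>)"
      by (rule partial_order_on_relation_ofI) auto
  next
    fix C assume "C \<in> Chains (relation_of (\<lambda>x y. y \<le> x) \<A>)"
    then have C: "C \<subseteq> \<A>" "\<And>x y. x \<in> C \<Longrightarrow> y \<in> C \<Longrightarrow> x \<le> y \<or> y \<le> x"
      by (auto simp: Chains_def relation_of_def)
    show "\<exists>u\<in>\<A>. \<forall>a\<in>C. u \<le> a"
    proof (cases "C = {}")
      case True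
      then show ?thesis using assms(1) by auto
    next
      case False
      then show ?thesis using chain[OF C(1)] C(2) by (meson Inf_lower)
    qed
  qed
  then show thesis using that by blast
qed

lemma ultrafilter_eventually_not:
  assumes "p \<in> ultrafilters S"
  shows "eventually (\<lambda>x. \<not> P x) p \<longleftrightarrow> \<not> eventually P p"
proof
  assume "eventually (\<lambda>x. \<not> P x) p"
  then show "\<not> eventually P p"
    using assms eventually_conj[of "\<lambda>x. \<not> P x" p P]
    by (auto simp: ultrafilters_def trivial_limit_def)
next
  assume "\<not> eventually P p"
  then show "eventually (\<lambda>x. \<not> P x) p"
    using assms by (auto simp: ultrafilters_def)
qed

lemma ultrafilter_eqI:
  assumes "p \<in> ultrafilters S" "q \<in> ultrafilters S"
    and "\<And>P. eventually P p \<Longrightarrow> eventually P q"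
  shows "p = q"
  unfolding filter_eq_iff
  using assms(3) ultrafilter_eventually_not[OF assms(1)] ultrafilter_eventually_not[OF assms(2)]
  by metis

lemma ultrafilters_mono: "S \<subseteq> T \<Longrightarrow> ultrafilters S \<subseteq> ultrafilters T"
  by (auto simp: ultrafilters_def le_principal elim: eventually_mono)

lemma ultrafilter_finite_Union:
  assumes p: "p \<in> ultrafilters S" and "finite \<B>" and B: "\<forall>\<^sub>F x in p. x \<in> \<Union>\<B>"
  obtains B where "B \<in> \<B>" "\<forall>\<^sub>F x in p. x \<in> B"
proof (rule ccontr)
  assume "\<not> thesis"
  then have "\<forall>B\<in>\<B>. \<forall>\<^sub>F x in p. x \<notin> B"
    using that by (auto simp: ultrafilter_eventually_not[OF p])
  then have "\<forall>\<^sub>F x in p. \<forall>B\<in>\<B>. x \<notin> B"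
    by (rule eventually_ball_finite[OF \<open>finite \<B>\<close>])
  then have "\<forall>\<^sub>F x in p. \<not> x \<in> \<Union>\<B>" by simp
  with B show False using ultrafilter_eventually_not[OF p] by blast
qed

text \<open>
  Ultrafilters are the minimal proper filters: \<open>P\<close> is decided by a minimal \<open>p\<close> because adjoining
  \<open>\<not> P\<close> to \<open>p\<close> yields either \<open>p\<close> itself or the improper filter.
\<close>

lemma ultrafilter_below:
  assumes "F \<noteq> bot" "F \<le> principal S"
  obtains p where "p \<in> ultrafilters S" "p \<le> F"
proof -
  let ?A = "{G. G \<noteq> bot \<and> G \<le> F}"
  obtain p where p: "p \<in> ?A" and min: "\<And>G. G \<in> ?A \<Longrightarrow> G \<le> p \<Longrightarrow> G = p"
  proof (rule Zorn_minimal[of ?A])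
    show "?A \<noteq> {}" using assms by auto
  next
    fix C assume C: "C \<subseteq> ?A" "C \<noteq> {}" "\<And>x y. x \<in> C \<Longrightarrow> y \<in> C \<Longrightarrow> x \<le> y \<or> y \<le> x"
    have "eventually P (Inf C) \<longleftrightarrow> (\<exists>G\<in>C. eventually P G)" for P
    proof (rule eventually_Inf_base[OF C(2)])
      fix G H assume "G \<in> C" "H \<in> C"
      then show "\<exists>x\<in>C. x \<le> inf G H"
        using C(3)[of G H] by (metis inf.absorb1 inf.absorb2 order_refl)
    qed
    then have "Inf C \<noteq> bot"
      using C(1) by (auto simp: trivial_limit_def)
    moreover have "Inf C \<le> F"
      using C(1,2) by (metis (no_types, lifting) Inf_lower2 equals0I mem_Collect_eq subsetD)
    ultimately show "Inf C \<in> ?A" by simp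
  qed auto
  have "eventually (\<lambda>x. \<not> P x) p" if "\<not> eventually P p" for P
  proof -
    have "inf p (principal {x. \<not> P x}) \<noteq> bot"
      using that by (simp add: trivial_limit_def eventually_inf_principal)
    then have "inf p (principal {x. \<not> P x}) = p"
      using p by (intro min) (auto intro: le_infI1)
    moreover have "eventually (\<lambda>x. \<not> P x) (inf p (principal {x. \<not> P x}))"
      by (simp add: eventually_inf_principal)
    ultimately show ?thesis by simp
  qed
  then have "p \<in> ultrafilters S"
    using p assms by (auto simp: ultrafilters_def)
  with p show thesis using that by auto
qed

section \<open>The compact topology on the space of ultrafilters\<close>

text \<open>
  Closed subsets in the topology with basis \<open>{p. A \<in> p}\<close>: an ultrafilter lies in the closure of
  \<open>C\<close> iff it contains every set that all members of \<open>C\<close> contain.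
\<close>

definition closed_ultrafilters :: "'a set \<Rightarrow> 'a filter set \<Rightarrow> bool" where
  "closed_ultrafilters S C \<longleftrightarrow>
     C \<subseteq> ultrafilters S \<and> (\<forall>p\<in>ultrafilters S. p \<le> Sup C \<longrightarrow> p \<in> C)"

lemma closed_ultrafiltersD:
  assumes "closed_ultrafilters S C"
  shows "p \<in> C \<Longrightarrow> p \<in> ultrafilters S"
    and "p \<in> ultrafilters S \<Longrightarrow> p \<le> Sup C \<Longrightarrow> p \<in> C"
  using assms by (auto simp: closed_ultrafilters_def)

lemma closed_ultrafilters_UNIV: "closed_ultrafilters S (ultrafilters S)"
  by (simp add: closed_ultrafilters_def)

lemma eventually_le_Sup_ultrafilters:
  assumes p: "p \<in> ultrafilters S" and "p \<le> Sup C" "C \<subseteq> ultrafilters S" "eventually P p"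
  obtains q where "q \<in> C" "eventually P q"
proof (rule ccontr)
  assume "\<not> thesis"
  then have "eventually (\<lambda>x. \<not> P x) (Sup C)"
    using that assms(3) ultrafilter_eventually_not by (fastforce simp: eventually_Sup)
  then have "eventually (\<lambda>x. \<not> P x) p"
    using assms(2) by (simp add: le_filter_def)
  with assms(4) ultrafilter_eventually_not[OF p] show False by blast
qed

lemma closed_ultrafilters_Inter:
  assumes "\<C> \<noteq> {}" "\<And>C. C \<in> \<C> \<Longrightarrow> closed_ultrafilters S C"
  shows "closed_ultrafilters S (\<Inter>\<C>)"
  unfolding closed_ultrafilters_def
proof (intro conjI ballI impI)
  show "\<Inter>\<C> \<subseteq> ultrafilters S"
    using assms by (auto simp: closed_ultrafilters_def)
next
  fix p assume p: "p \<in> ultrafilters S" "p \<le> Sup (\<Inter>\<C>)"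
  show "p \<in> \<Inter>\<C>"
  proof
    fix C assume "C \<in> \<C>"
    then have "p \<le> Sup C"
      using p(2) by (meson Inter_lower Sup_subset_mono order_trans)
    then show "p \<in> C"
      using assms(2)[OF \<open>C \<in> \<C>\<close>] p(1) by (blast intro: closed_ultrafiltersD)
  qed
qed

text \<open>
  Compactness, in the form in which Zorn's lemma consumes it: the filters \<open>Sup C\<close> form a chain, so
  their infimum is proper, and an ultrafilter below that infimum is in the closure of every \<open>C\<close>.
\<close>

lemma closed_ultrafilters_chain_nonempty:
  assumes "\<C> \<noteq> {}" and C: "\<And>C. C \<in> \<C> \<Longrightarrow> closed_ultrafilters S C \<and> C \<noteq> {}"
    and chain: "\<And>C D. C \<in> \<C> \<Longrightarrow> D \<in> \<C> \<Longrightarrow> C \<subseteq> D \<or> D \<subseteq> C"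
  shows "\<Inter>\<C> \<noteq> {}"
proof -
  let ?F = "INF C\<in>\<C>. Sup C"
  have ev: "eventually P ?F \<longleftrightarrow> (\<exists>C\<in>\<C>. eventually P (Sup C))" for P
  proof (rule eventually_INF_base[OF assms(1)])
    fix C D assume "C \<in> \<C>" "D \<in> \<C>"
    then show "\<exists>x\<in>\<C>. Sup x \<le> inf (Sup C) (Sup D)"
      using chain[of C D] by (metis Sup_subset_mono inf.bounded_iff order_refl)
  qed
  have "?F \<noteq> bot"
  proof
    assume "?F = bot"
    then obtain D where D: "D \<in> \<C>" "eventually (\<lambda>x. False) (Sup D)"
      using ev[of "\<lambda>x. False"] by (auto simp: trivial_limit_def)
    then obtain p where "p \<in> D" "p \<in> ultrafilters S" "eventually (\<lambda>x. False) p"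
      using C[of D] by (auto simp: eventually_Sup closed_ultrafilters_def)
    then show False by (simp add: ultrafilters_def trivial_limit_def)
  qed
  moreover have "eventually (\<lambda>x. x \<in> S) ?F"
  proof -
    obtain D where D: "D \<in> \<C>" using assms(1) by blast
    have "eventually (\<lambda>x. x \<in> S) (Sup D)"
      using closed_ultrafiltersD(1) C[OF D]
      by (auto simp: eventually_Sup ultrafilters_def le_principal)
    with D show ?thesis by (auto simp: ev)
  qed
  ultimately obtain p where p: "p \<in> ultrafilters S" "p \<le> ?F"
    using ultrafilter_below[of ?F S] by (auto simp: le_principal)
  have "p \<in> C" if "C \<in> \<C>" for C
    using p C[OF that] INF_lower[OF that, of Sup] by (meson closed_ultrafiltersD(2) order_trans)
  then show ?thesis by blast
qed

lemma minimal_closed_ultrafilters: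
  assumes C: "closed_ultrafilters S C" "C \<noteq> {}" "\<Phi> C"
    and Inter: "\<And>\<C>. \<C> \<noteq> {} \<Longrightarrow> (\<And>C. C \<in> \<C> \<Longrightarrow> \<Phi> C) \<Longrightarrow> \<Phi> (\<Inter>\<C>)"
  obtains M where "M \<subseteq> C" "closed_ultrafilters S M" "M \<noteq> {}" "\<Phi> M"
    "\<And>D. D \<subseteq> M \<Longrightarrow> closed_ultrafilters S D \<Longrightarrow> D \<noteq> {} \<Longrightarrow> \<Phi> D \<Longrightarrow> D = M"
proof -
  let ?A = "{D. D \<subseteq> C \<and> closed_ultrafilters S D \<and> D \<noteq> {} \<and> \<Phi> D}"
  obtain M where M: "M \<in> ?A" and min: "\<And>D. D \<in> ?A \<Longrightarrow> D \<subseteq> M \<Longrightarrow> D = M"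
  proof (rule Zorn_minimal[of ?A])
    show "?A \<noteq> {}" using C by auto
  next
    fix \<C> assume ch: "\<C> \<subseteq> ?A" "\<C> \<noteq> {}" "\<And>D E. D \<in> \<C> \<Longrightarrow> E \<in> \<C> \<Longrightarrow> D \<subseteq> E \<or> E \<subseteq> D"
    have "\<Inter>\<C> \<subseteq> C" using ch(1,2) by blast
    moreover have "closed_ultrafilters S (\<Inter>\<C>)"
      using ch(1,2) by (intro closed_ultrafilters_Inter) auto
    moreover have "\<Inter>\<C> \<noteq> {}"
      using ch by (intro closed_ultrafilters_chain_nonempty[where S = S]) auto
    moreover have "\<Phi> (\<Inter>\<C>)" using ch(1,2) by (intro Inter) auto
    ultimately show "\<Inter>\<C> \<in> ?A" by simp
  qed auto
  show thesis
  proof (rule that[of M])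
    fix D assume "D \<subseteq> M" "closed_ultrafilters S D" "D \<noteq> {}" "\<Phi> D"
    then show "D = M" using M by (intro min) auto
  qed (use M in auto)
qed

section \<open>Ultrafilters on a semigroup\<close>

locale carrier_semigroup =
  fixes S :: "'a set" and f :: "'a \<Rightarrow> 'a \<Rightarrow> 'a"
  assumes op_closed: "x \<in> S \<Longrightarrow> y \<in> S \<Longrightarrow> f x y \<in> S"
    and op_assoc: "x \<in> S \<Longrightarrow> y \<in> S \<Longrightarrow> z \<in> S \<Longrightarrow> f (f x y) z = f x (f y z)"
begin

abbreviation ultra_mult (infixl \<open>\<star>\<close> 70) where
  "p \<star> q \<equiv> ultra_op f p q"

lemma mult_closed: "p \<in> ultrafilters S \<Longrightarrow> q \<in> ultrafilters S \<Longrightarrow> p \<star> q \<in> ultrafilters S"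
  by (rule ultra_op_closed[OF op_closed])

lemma mult_assoc:
  "p \<in> ultrafilters S \<Longrightarrow> q \<in> ultrafilters S \<Longrightarrow> r \<in> ultrafilters S \<Longrightarrow> p \<star> q \<star> r = p \<star> (q \<star> r)"
  by (rule ultra_op_assoc[OF op_assoc])

text \<open>
  The next two lemmas are the continuity of right multiplication by \<open>q\<close>: preimages of points are
  closed, and (with compactness) images of closed sets are closed.
\<close>

lemma closed_fiber:
  assumes T: "closed_ultrafilters S T" and q: "q \<in> ultrafilters S" and r: "r \<in> ultrafilters S"
  shows "closed_ultrafilters S {t \<in> T. t \<star> q = r}"
  unfolding closed_ultrafilters_def
proof (intro conjI ballI impI)
  show "{t \<in> T. t \<star> q = r} \<subseteq> ultrafilters S"
    using closed_ultrafiltersD(1)[OF T] by auto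
next
  fix p assume p: "p \<in> ultrafilters S" "p \<le> Sup {t \<in> T. t \<star> q = r}"
  have "p \<le> Sup T"
    using p(2) by (rule order_trans) (auto intro: Sup_subset_mono)
  then have "p \<in> T" using closed_ultrafiltersD(2)[OF T p(1)] by blast
  moreover have "r = p \<star> q"
  proof (rule ultrafilter_eqI[OF r mult_closed[OF p(1) q]])
    fix P assume "eventually P r"
    then have "\<forall>\<^sub>F s in Sup {t \<in> T. t \<star> q = r}. \<forall>\<^sub>F x in q. P (f s x)"
      by (auto simp: eventually_Sup eventually_ultra_op)
    then show "eventually P (p \<star> q)"
      using p(2) by (auto simp: eventually_ultra_op le_filter_def)
  qed
  ultimately show "p \<in> {t \<in> T. t \<star> q = r}" by simp
qed

lemma closed_image:
  assumes T: "closed_ultrafilters S T" and q: "q \<in> ultrafilters S"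
  shows "closed_ultrafilters S ((\<lambda>t. t \<star> q) ` T)"
  unfolding closed_ultrafilters_def
proof (intro conjI ballI impI)
  show sub: "(\<lambda>t. t \<star> q) ` T \<subseteq> ultrafilters S"
    using closed_ultrafiltersD(1)[OF T] mult_closed q by auto
  fix r assume r: "r \<in> ultrafilters S" "r \<le> Sup ((\<lambda>t. t \<star> q) ` T)"
  \<comment> \<open>Any ultrafilter below \<open>G\<close> is a solution \<open>t\<close> of \<open>t \<star> q = r\<close>.\<close>
  define G where "G = (INF P\<in>{P. eventually P r}. principal {s. \<forall>\<^sub>F x in q. P (f s x)})"
  have ev: "eventually Q G \<longleftrightarrow>
      (\<exists>P. eventually P r \<and> (\<forall>s. (\<forall>\<^sub>F x in q. P (f s x)) \<longrightarrow> Q s))" for Q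
  proof -
    have "eventually Q G \<longleftrightarrow>
      (\<exists>P\<in>{P. eventually P r}. eventually Q (principal {s. \<forall>\<^sub>F x in q. P (f s x)}))"
      unfolding G_def
    proof (rule eventually_INF_base)
      show "{P. eventually P r} \<noteq> {}" using eventually_True by blast
    next
      fix P Q assume "P \<in> {P. eventually P r}" "Q \<in> {P. eventually P r}"
      then show "\<exists>R\<in>{P. eventually P r}. principal {s. \<forall>\<^sub>F x in q. R (f s x)} \<le>
          inf (principal {s. \<forall>\<^sub>F x in q. P (f s x)}) (principal {s. \<forall>\<^sub>F x in q. Q (f s x)})"
        by (intro bexI[of _ "\<lambda>x. P x \<and> Q x"]) (auto simp: eventually_conj_iff)
    qed
    then show ?thesis by (auto simp: eventually_principal)
  qed
  have "inf (Sup T) G \<noteq> bot"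
  proof
    assume "inf (Sup T) G = bot"
    then obtain Q P where Q: "eventually Q (Sup T)" and P: "eventually P r"
      and disj: "\<And>s. Q s \<Longrightarrow> \<not> (\<forall>\<^sub>F x in q. P (f s x))"
      by (auto simp: trivial_limit_def eventually_inf ev)
    obtain t where t: "t \<in> T" "eventually P (t \<star> q)"
      using eventually_le_Sup_ultrafilters[OF r sub P] by auto
    from Q t(1) have "eventually Q t" by (simp add: eventually_Sup)
    moreover have "\<forall>\<^sub>F s in t. \<forall>\<^sub>F x in q. P (f s x)" using t(2) by (simp add: eventually_ultra_op)
    ultimately have "\<forall>\<^sub>F s in t. False" by eventually_elim (use disj in blast)
    with closed_ultrafiltersD(1)[OF T t(1)] show False
      by (simp add: ultrafilters_def trivial_limit_def)
  qed
  moreover have "inf (Sup T) G \<le> principal S"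
    using closed_ultrafiltersD(1)[OF T]
    by (intro le_infI1 Sup_least) (auto simp: ultrafilters_def)
  ultimately obtain t where t: "t \<in> ultrafilters S" "t \<le> Sup T" "t \<le> G"
    using ultrafilter_below by (metis le_inf_iff)
  have "r = t \<star> q"
  proof (rule ultrafilter_eqI[OF r(1) mult_closed[OF t(1) q]])
    fix P assume "eventually P r"
    then have "\<forall>\<^sub>F s in G. \<forall>\<^sub>F x in q. P (f s x)" by (auto simp: ev)
    then show "eventually P (t \<star> q)"
      using t(3) by (simp add: eventually_ultra_op le_filter_def)
  qed
  then show "r \<in> (\<lambda>t. t \<star> q) ` T"
    using closed_ultrafiltersD(2)[OF T t(1,2)] by blast
qed

text \<open>
  Ellis's theorem. Every element of a minimal closed subsemigroup \<open>M\<close> is idempotent: for \<open>x \<in> M\<close>, minimality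
  gives \<open>M \<star> x = M\<close>, hence \<open>{y \<in> M. y \<star> x = x}\<close> is a nonempty closed subsemigroup and so equals \<open>M\<close>.
\<close>

lemma closed_subsemigroup_has_idempotent:
  assumes T: "closed_ultrafilters S T" "T \<noteq> {}" "\<forall>x\<in>T. \<forall>y\<in>T. x \<star> y \<in> T"
  obtains e where "e \<in> T" "e \<star> e = e"
proof -
  obtain M where M: "M \<subseteq> T" "closed_ultrafilters S M" "M \<noteq> {}" "\<forall>x\<in>M. \<forall>y\<in>M. x \<star> y \<in> M"
    and min: "\<And>D. D \<subseteq> M \<Longrightarrow> closed_ultrafilters S D \<Longrightarrow> D \<noteq> {} \<Longrightarrow> \<forall>x\<in>D. \<forall>y\<in>D. x \<star> y \<in> D \<Longrightarrow> D = M"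
    by (rule minimal_closed_ultrafilters[of S T "\<lambda>M. \<forall>x\<in>M. \<forall>y\<in>M. x \<star> y \<in> M"])
       (use T in auto)
  note Mu = closed_ultrafiltersD(1)[OF M(2)]
  obtain x where x: "x \<in> M" using M(3) by blast
  have "(\<lambda>t. t \<star> x) ` M = M"
  proof (rule min)
    show "(\<lambda>t. t \<star> x) ` M \<subseteq> M" using M(4) x by auto
    show "closed_ultrafilters S ((\<lambda>t. t \<star> x) ` M)" by (rule closed_image[OF M(2) Mu[OF x]])
    show "(\<lambda>t. t \<star> x) ` M \<noteq> {}" using x by auto
    have "s \<star> x \<star> (t \<star> x) = s \<star> x \<star> t \<star> x" if "s \<in> M" "t \<in> M" for s t
      by (simp add: mult_assoc mult_closed Mu that x)
    then show "\<forall>y\<in>(\<lambda>t. t \<star> x) ` M. \<forall>z\<in>(\<lambda>t. t \<star> x) ` M. y \<star> z \<in> (\<lambda>t. t \<star> x) ` M"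
      using M(4) x by auto
  qed
  then obtain y where y: "y \<in> M" "y \<star> x = x" using x by (metis imageE)
  have "{y \<in> M. y \<star> x = x} = M"
  proof (rule min)
    show "closed_ultrafilters S {y \<in> M. y \<star> x = x}" by (rule closed_fiber[OF M(2) Mu[OF x] Mu[OF x]])
    show "\<forall>y\<in>{y \<in> M. y \<star> x = x}. \<forall>z\<in>{y \<in> M. y \<star> x = x}. y \<star> z \<in> {y \<in> M. y \<star> x = x}"
      using M(4) by (auto simp: mult_assoc Mu x)
  qed (use y in auto)
  then have "x \<star> x = x" using x by blast
  with x M(1) show thesis using that by blast
qed

definition left_ideal :: "'a filter set \<Rightarrow> bool" where
  "left_ideal L \<longleftrightarrow>
     L \<noteq> {} \<and> L \<subseteq> ultrafilters S \<and> (\<forall>p\<in>ultrafilters S. \<forall>q\<in>L. p \<star> q \<in> L)"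

lemma principal_left_ideal:
  assumes q: "q \<in> ultrafilters S"
  shows "left_ideal ((\<lambda>p. p \<star> q) ` ultrafilters S)"
  unfolding left_ideal_def
proof (intro conjI ballI)
  show "(\<lambda>p. p \<star> q) ` ultrafilters S \<noteq> {}" using q by auto
  show "(\<lambda>p. p \<star> q) ` ultrafilters S \<subseteq> ultrafilters S" using q mult_closed by auto
  fix p r assume "p \<in> ultrafilters S" "r \<in> (\<lambda>p. p \<star> q) ` ultrafilters S"
  then show "p \<star> r \<in> (\<lambda>p. p \<star> q) ` ultrafilters S"
    using q by (auto simp: mult_assoc[symmetric] mult_closed)
qed

text \<open>
  A left ideal contains the closed left ideals generated by its points, so minimality among closed
  left ideals, which compactness provides, is minimality among all left ideals.
\<close>

lemma left_ideal_contains_minimal: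
  assumes L: "left_ideal L"
  obtains M where "M \<subseteq> L" "left_ideal M" "closed_ultrafilters S M"
    "\<And>N. left_ideal N \<Longrightarrow> N \<subseteq> M \<Longrightarrow> N = M"
proof -
  obtain q where q: "q \<in> L" "q \<in> ultrafilters S" using L by (auto simp: left_ideal_def)
  let ?orbit = "\<lambda>q. (\<lambda>p. p \<star> q) ` ultrafilters S"
  let ?\<Phi> = "\<lambda>M. \<forall>p\<in>ultrafilters S. \<forall>q\<in>M. p \<star> q \<in> M"
  obtain M where M: "M \<subseteq> ?orbit q" "closed_ultrafilters S M" "M \<noteq> {}" "?\<Phi> M"
    and min: "\<And>D. D \<subseteq> M \<Longrightarrow> closed_ultrafilters S D \<Longrightarrow> D \<noteq> {} \<Longrightarrow> ?\<Phi> D \<Longrightarrow> D = M"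
  proof (rule minimal_closed_ultrafilters[of S "?orbit q" ?\<Phi>])
    show "closed_ultrafilters S (?orbit q)"
      by (rule closed_image[OF closed_ultrafilters_UNIV q(2)])
    show "?orbit q \<noteq> {}" "?\<Phi> (?orbit q)"
      using principal_left_ideal[OF q(2)] unfolding left_ideal_def by blast+
    show "?\<Phi> (\<Inter>\<C>)" if "\<And>C. C \<in> \<C> \<Longrightarrow> ?\<Phi> C" for \<C>
      using that by blast
  qed (use that in blast)
  show thesis
  proof (rule that[of M])
    show "M \<subseteq> L" using M(1) L q by (auto simp: left_ideal_def)
    show "left_ideal M"
      using M closed_ultrafiltersD(1)[OF M(2)] by (auto simp: left_ideal_def)
    show "closed_ultrafilters S M" by fact
    fix N assume N: "left_ideal N" "N \<subseteq> M"
    then obtain n where n: "n \<in> N" "n \<in> ultrafilters S" by (auto simp: left_ideal_def)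
    have sub: "?orbit n \<subseteq> N" using N(1) n(1) by (auto simp: left_ideal_def)
    have "?orbit n = M"
    proof (rule min)
      show "?orbit n \<subseteq> M" using sub N(2) by blast
      show "closed_ultrafilters S (?orbit n)"
        by (rule closed_image[OF closed_ultrafilters_UNIV n(2)])
      show "?orbit n \<noteq> {}" "?\<Phi> (?orbit n)"
        using principal_left_ideal[OF n(2)] unfolding left_ideal_def by blast+
    qed
    with sub N(2) show "N = M" by blast
  qed
qed

lemma minimal_left_ideal_subset_ideal:
  assumes M: "left_ideal M" "\<And>N. left_ideal N \<Longrightarrow> N \<subseteq> M \<Longrightarrow> N = M"
    and I: "two_sided_ideal S f I"
  shows "M \<subseteq> I"
proof -
  obtain i m where im: "i \<in> I" "i \<in> ultrafilters S" "m \<in> M" "m \<in> ultrafilters S"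
    using I M(1) unfolding two_sided_ideal_def left_ideal_def by blast
  \<comment> \<open>The product \<open>i \<star> m\<close> shows that the left ideal \<open>M \<inter> I\<close> is nonempty.\<close>
  then have "i \<star> m \<in> M \<inter> I"
    using I M(1) by (auto simp: two_sided_ideal_def left_ideal_def)
  then have "left_ideal (M \<inter> I)"
    using I M(1) unfolding two_sided_ideal_def left_ideal_def by blast
  then show ?thesis using M(2)[of "M \<inter> I"] by blast
qed

text \<open>
  A minimal left ideal \<open>M\<close> lies in every two-sided ideal, hence so does \<open>M \<star> \<beta>S\<close>; being two-sided
  itself, it is the smallest one.
\<close>

lemma smallest_ideal_least:
  assumes "ultrafilters S \<noteq> {}"
  shows smallest_ideal_two_sided: "two_sided_ideal S f (smallest_ideal S f)"
    and smallest_ideal_subset: "two_sided_ideal S f I \<Longrightarrow> smallest_ideal S f \<subseteq> I"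
proof -
  have "left_ideal (ultrafilters S)"
    using assms mult_closed by (auto simp: left_ideal_def)
  then obtain M where M: "left_ideal M" "\<And>N. left_ideal N \<Longrightarrow> N \<subseteq> M \<Longrightarrow> N = M"
    using left_ideal_contains_minimal by metis
  then have Mu: "\<And>m. m \<in> M \<Longrightarrow> m \<in> ultrafilters S"
    and Ml: "\<And>p m. p \<in> ultrafilters S \<Longrightarrow> m \<in> M \<Longrightarrow> p \<star> m \<in> M"
    by (auto simp: left_ideal_def)
  define K where "K = {m \<star> p |m p. m \<in> M \<and> p \<in> ultrafilters S}"
  have K: "two_sided_ideal S f K"
    unfolding two_sided_ideal_def
  proof (intro conjI ballI)
    show "K \<noteq> {}" using M(1) assms by (auto simp: K_def left_ideal_def)
    show "K \<subseteq> ultrafilters S" using Mu mult_closed by (auto simp: K_def)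
    fix p k assume p: "p \<in> ultrafilters S" and "k \<in> K"
    then obtain m r where k: "k = m \<star> r" "m \<in> M" "r \<in> ultrafilters S" by (auto simp: K_def)
    have "p \<star> k = p \<star> m \<star> r" "k \<star> p = m \<star> (r \<star> p)"
      using k p Mu by (auto simp: mult_assoc)
    then show "p \<star> k \<in> K" "k \<star> p \<in> K"
      using k p Ml mult_closed unfolding K_def by blast+
  qed
  have least: "K \<subseteq> I" if I: "two_sided_ideal S f I" for I
    using minimal_left_ideal_subset_ideal[OF M I] I by (auto simp: K_def two_sided_ideal_def)
  have "smallest_ideal S f = K"
    unfolding smallest_ideal_def by (rule Least_equality) (use K least in auto)
  with K least show "two_sided_ideal S f (smallest_ideal S f)"
    and "two_sided_ideal S f I \<Longrightarrow> smallest_ideal S f \<subseteq> I" by auto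
qed

lemma left_ideal_contains_minimal_idempotent:
  assumes L: "left_ideal L"
  obtains e where "e \<in> L" "e \<in> smallest_ideal S f" "e \<star> e = e"
proof -
  obtain M where M: "M \<subseteq> L" "left_ideal M" "closed_ultrafilters S M"
    "\<And>N. left_ideal N \<Longrightarrow> N \<subseteq> M \<Longrightarrow> N = M"
    using left_ideal_contains_minimal[OF L] by metis
  obtain e where e: "e \<in> M" "e \<star> e = e"
  proof (rule closed_subsemigroup_has_idempotent[OF M(3)])
    show "M \<noteq> {}" "\<forall>x\<in>M. \<forall>y\<in>M. x \<star> y \<in> M"
      using M(2) unfolding left_ideal_def by blast+
  qed
  have "ultrafilters S \<noteq> {}" using L by (auto simp: left_ideal_def)
  then have "M \<subseteq> smallest_ideal S f"
    using minimal_left_ideal_subset_ideal[OF M(2,4)] smallest_ideal_two_sided by blast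
  with e M(1) show thesis using that by blast
qed

end

section \<open>Additive centrality under multiplication by a fixed element\<close>

lemma carrier_semigroup_add: "carrier_semigroup (UNIV :: 'a::semigroup_add set) (+)"
  by unfold_locales (auto simp: add.assoc)

lemma principal_singleton_ultrafilter: "x \<in> S \<Longrightarrow> principal {x} \<in> ultrafilters S"
  by (auto simp: ultrafilters_def principal_eq_bot_iff eventually_principal)

lemma filtermap_ultrafilter: "p \<in> ultrafilters UNIV \<Longrightarrow> filtermap h p \<in> ultrafilters UNIV"
  by (auto simp: ultrafilters_def filtermap_bot_iff eventually_filtermap)

lemma filtermap_additive_ultra_op:
  fixes h :: "'a::plus \<Rightarrow> 'b::plus"
  assumes "\<And>x y. h (x + y) = h x + h y"
  shows "filtermap h (ultra_op (+) p q) = ultra_op (+) (filtermap h p) (filtermap h q)"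
  by (simp add: filter_eq_iff eventually_filtermap eventually_ultra_op assms)

lemma ideal_meets_finite_index_subgroup:
  fixes H :: "'a::ab_group_add set"
  assumes H: "finite_index_subgroup H" and I: "two_sided_ideal UNIV (+) I"
  obtains p where "p \<in> I" "\<forall>\<^sub>F x in p. x \<in> H"
proof -
  obtain p where p: "p \<in> I" "p \<in> ultrafilters UNIV" using I by (auto simp: two_sided_ideal_def)
  have "\<Union>(range (\<lambda>x. (+) x ` H)) = UNIV"
    using H by (force simp: finite_index_subgroup_def)
  then obtain B where B: "B \<in> range (\<lambda>x. (+) x ` H)" "\<forall>\<^sub>F y in p. y \<in> B"
    using ultrafilter_finite_Union[OF p(2), of "range (\<lambda>x. (+) x ` H)"] H
    by (auto simp: finite_index_subgroup_def)
  then obtain x where x: "\<forall>\<^sub>F y in p. y \<in> (+) x ` H" by auto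
  \<comment> \<open>Translation by \<open>- x\<close> is addition of a principal ultrafilter, so it does not leave \<open>I\<close>.\<close>
  have "ultra_op (+) (principal {- x}) p \<in> I"
    using I p(1) principal_singleton_ultrafilter[of "- x" UNIV] by (auto simp: two_sided_ideal_def)
  moreover have "\<forall>\<^sub>F y in ultra_op (+) (principal {- x}) p. y \<in> H"
    using x by (auto simp: eventually_ultra_op eventually_principal elim!: eventually_mono)
  ultimately show thesis using that by blast
qed

lemma ultrafilter_eq_filtermap:
  assumes q: "q \<in> ultrafilters UNIV" and "\<forall>\<^sub>F x in q. x \<in> range h"
  obtains p where "p \<in> ultrafilters UNIV" "filtermap h p = q"
proof -
  have "(\<forall>\<^sub>F x in q. P (h (inv h x))) \<longleftrightarrow> eventually P q" for P
    by (rule eventually_cong[OF assms(2)]) (simp add: f_inv_into_f)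
  then have "filtermap h (filtermap (inv h) q) = q"
    by (simp add: filter_eq_iff eventually_filtermap)
  then show thesis
    by (rule that[OF filtermap_ultrafilter[OF q]])
qed

text \<open>
  The preimage of \<open>K(\<beta>R, +)\<close> under the homomorphism \<open>\<beta>R \<rightarrow> \<beta>R\<close> induced by \<open>h\<close> is a two-sided
  ideal, provided that it is nonempty; hence it contains \<open>K(\<beta>R, +)\<close>. Finite index of the range
  gives nonemptiness, since \<open>K(\<beta>R, +)\<close> then meets the range of the induced map.
\<close>

lemma filtermap_smallest_ideal:
  fixes h :: "'a::ab_group_add \<Rightarrow> 'a"
  assumes add: "\<And>x y. h (x + y) = h x + h y" and H: "finite_index_subgroup (range h)"
    and q: "q \<in> smallest_ideal UNIV (+)"
  shows "filtermap h q \<in> smallest_ideal UNIV (+)"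
proof -
  interpret carrier_semigroup "UNIV :: 'a set" "(+)" by (rule carrier_semigroup_add)
  let ?K = "smallest_ideal UNIV ((+) :: 'a \<Rightarrow> 'a \<Rightarrow> 'a)"
  let ?J = "{p \<in> ultrafilters UNIV. filtermap h p \<in> ?K}"
  have ne: "ultrafilters (UNIV :: 'a set) \<noteq> {}"
    using principal_singleton_ultrafilter[of 0 UNIV] by auto
  note K = smallest_ideal_two_sided[OF ne]
  have "two_sided_ideal UNIV (+) ?J"
    unfolding two_sided_ideal_def
  proof (intro conjI ballI)
    obtain r where r: "r \<in> ?K" "\<forall>\<^sub>F x in r. x \<in> range h"
      using ideal_meets_finite_index_subgroup[OF H K] by blast
    then have "r \<in> ultrafilters UNIV" using K by (auto simp: two_sided_ideal_def)
    with r show "?J \<noteq> {}" using ultrafilter_eq_filtermap[of r h] by blast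
    fix p r :: "'a filter" assume p: "p \<in> ultrafilters UNIV" and r: "r \<in> ?J"
    then show "ultra_op (+) p r \<in> ?J" "ultra_op (+) r p \<in> ?J"
      using K filtermap_ultrafilter[OF p, of h] mult_closed
      by (auto simp: filtermap_additive_ultra_op[of h, OF add] two_sided_ideal_def)
  qed auto
  then show ?thesis using smallest_ideal_subset[OF ne] q by blast
qed

lemma central_image:
  fixes h :: "'a::ab_group_add \<Rightarrow> 'a"
  assumes add: "\<And>x y. h (x + y) = h x + h y" and H: "finite_index_subgroup (range h)"
    and A: "central UNIV (+) {x. h x \<in> A}"
  shows "central UNIV (+) A"
proof -
  obtain q where q: "q \<in> smallest_ideal UNIV (+)" "ultra_op (+) q q = q" "\<forall>\<^sub>F x in q. h x \<in> A"
    using A by (auto simp: central_def)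
  have "ultra_op (+) (filtermap h q) (filtermap h q) = filtermap h q"
    using q(2) filtermap_additive_ultra_op[of h, OF add] by metis
  then show ?thesis
    using filtermap_smallest_ideal[OF add H q(1)] q(3)
    by (auto simp: central_def eventually_filtermap intro!: bexI[of _ "filtermap h q"])
qed

section \<open>Nonprincipal ultrafilters\<close>

lemma infinite_imp_nonprincipal_ultrafilter:
  assumes "infinite (UNIV :: 'a set)"
  shows "\<exists>p \<in> ultrafilters UNIV. \<forall>(a::'a). \<forall>\<^sub>F x in p. x \<noteq> a"
proof -
  have "cofinite \<noteq> (bot :: 'a filter)"
    using assms by (simp add: trivial_limit_def eventually_cofinite)
  then obtain p :: "'a filter" where p: "p \<in> ultrafilters UNIV" "p \<le> cofinite"
    using ultrafilter_below[of cofinite UNIV] by auto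
  have "\<forall>\<^sub>F x in p. x \<noteq> a" for a
    using p(2) by (auto simp: le_filter_def eventually_cofinite)
  with p(1) show ?thesis by blast
qed

text \<open>
  In a group, \<open>s + x = a\<close> has exactly one solution in each variable, so a sum of two ultrafilters
  cannot concentrate on \<open>a\<close> when one of them is nonprincipal. This ideal contains \<open>K(\<beta>R, +)\<close>;
  in particular, no minimal idempotent of \<open>(\<beta>R, +)\<close> is the principal ultrafilter at \<open>0\<close>.
\<close>

lemma nonprincipal_two_sided_ideal:
  assumes "infinite (UNIV :: 'a::ab_group_add set)"
  shows "two_sided_ideal UNIV (+) {p \<in> ultrafilters UNIV. \<forall>(a::'a). \<forall>\<^sub>F x in p. x \<noteq> a}"
    (is "two_sided_ideal _ _ ?I")
  unfolding two_sided_ideal_def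
proof (intro conjI ballI)
  interpret carrier_semigroup "UNIV :: 'a set" "(+)" by (rule carrier_semigroup_add)
  show "?I \<noteq> {}" using infinite_imp_nonprincipal_ultrafilter[OF assms] by auto
  fix p q :: "'a filter" assume p: "p \<in> ultrafilters UNIV" and q: "q \<in> ?I"
  have q': "q \<in> ultrafilters UNIV" "\<And>a. \<forall>\<^sub>F x in q. x \<noteq> a" using q by auto
  have "\<forall>\<^sub>F s in p. \<forall>\<^sub>F x in q. s + x \<noteq> a" for a
  proof (rule always_eventually, rule allI)
    fix s show "\<forall>\<^sub>F x in q. s + x \<noteq> a"
      using q'(2)[of "a - s"] by (auto elim!: eventually_mono)
  qed
  then show "ultra_op (+) p q \<in> ?I"
    using mult_closed[OF p q'(1)] by (simp add: eventually_ultra_op)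
  have "\<forall>\<^sub>F s in q. \<forall>\<^sub>F x in p. s + x \<noteq> a" for a
  proof (rule ccontr)
    assume "\<not> (\<forall>\<^sub>F s in q. \<forall>\<^sub>F x in p. s + x \<noteq> a)"
    then have *: "\<forall>\<^sub>F s in q. \<forall>\<^sub>F x in p. s + x = a"
      by (simp add: ultrafilter_eventually_not[OF q'(1), symmetric] ultrafilter_eventually_not[OF p])
    \<comment> \<open>If \<open>p\<close> concentrates on \<open>a - s\<close> for two values of \<open>s\<close>, it concentrates on nothing.\<close>
    have "q \<noteq> bot" "p \<noteq> bot" using p q' by (auto simp: ultrafilters_def)
    then obtain s where s: "\<forall>\<^sub>F x in p. s + x = a" using * eventually_happens' by blast
    have "\<forall>\<^sub>F t in q. t \<noteq> s \<and> (\<forall>\<^sub>F x in p. t + x = a)" using * q'(2) by (simp add: eventually_conj_iff)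
    then obtain t where t: "t \<noteq> s" "\<forall>\<^sub>F x in p. t + x = a"
      using eventually_happens'[OF \<open>q \<noteq> bot\<close>] by blast
    from s t(2) have "\<forall>\<^sub>F x in p. False"
      by eventually_elim (use t(1) in \<open>metis add_right_cancel\<close>)
    with \<open>p \<noteq> bot\<close> show False by (simp add: trivial_limit_def)
  qed
  then show "ultra_op (+) q p \<in> ?I"
    using mult_closed[OF q'(1) p] by (simp add: eventually_ultra_op)
qed auto

section \<open>Additively and multiplicatively central sets\<close>

theorem corollary7:
  assumes "infinite (UNIV :: 'a::ring_no_zero_divisors set)"
    and "right_homomorphically_finite TYPE('a)"
  shows "\<exists>p \<in> ultrafilters (UNIV :: 'a set).
           \<forall>A. (\<forall>\<^sub>F x in p. x \<in> A) \<longrightarrow>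
             central UNIV (+) A \<and> central (UNIV - {0}) (*) (A - {0})"
proof -
  let ?R = "UNIV - {0 :: 'a}"
  interpret add: carrier_semigroup "UNIV :: 'a set" "(+)" by (rule carrier_semigroup_add)
  interpret mult: carrier_semigroup ?R "(*)"
    by unfold_locales (auto simp: mult.assoc)
  have ne: "ultrafilters (UNIV :: 'a set) \<noteq> {}"
    using principal_singleton_ultrafilter[of 0 UNIV] by auto
  define L where "L = {p \<in> ultrafilters (?R). \<forall>A. (\<forall>\<^sub>F x in p. x \<in> A) \<longrightarrow> central UNIV (+) A}"
  have "mult.left_ideal L"
    unfolding mult.left_ideal_def
  proof (intro conjI ballI)
    have "add.left_ideal (ultrafilters UNIV)"
      using ne add.mult_closed by (auto simp: add.left_ideal_def)
    then obtain e :: "'a filter" where e: "e \<in> ultrafilters UNIV" "e \<in> smallest_ideal UNIV (+)"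
      "ultra_op (+) e e = e"
      by (rule add.left_ideal_contains_minimal_idempotent)
    have "e \<in> {p \<in> ultrafilters UNIV. \<forall>(a::'a). \<forall>\<^sub>F x in p. x \<noteq> a}"
      by (rule subsetD[OF add.smallest_ideal_subset[OF ne nonprincipal_two_sided_ideal[OF assms(1)]] e(2)])
    then have "e \<in> ultrafilters ?R" using e(1) by (simp add: ultrafilters_def le_principal)
    with e show "L \<noteq> {}" by (auto simp: L_def central_def)
    show "L \<subseteq> ultrafilters ?R" by (auto simp: L_def)
    fix p q assume p: "p \<in> ultrafilters ?R" and q: "q \<in> L"
    have "central UNIV (+) A" if A: "\<forall>\<^sub>F x in ultra_op (*) p q. x \<in> A" for A
    proof -
      have "\<forall>\<^sub>F s in p. s \<noteq> 0 \<and> (\<forall>\<^sub>F x in q. s * x \<in> A)"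
        using A p by (auto simp: eventually_ultra_op eventually_conj_iff ultrafilters_def le_principal)
      then obtain s where s: "s \<noteq> 0" "\<forall>\<^sub>F x in q. s * x \<in> A"
        using p eventually_happens' unfolding ultrafilters_def by blast
      show ?thesis
      proof (rule central_image)
        show "s * (x + y) = s * x + s * y" for x y by (rule distrib_left)
        show "finite_index_subgroup (range ((*) s))"
          using assms(2) s(1) by (simp add: right_homomorphically_finite_def)
        show "central UNIV (+) {x. s * x \<in> A}" using q s(2) by (simp add: L_def)
      qed
    qed
    then show "ultra_op (*) p q \<in> L"
      using mult.mult_closed[OF p] q by (simp add: L_def)
  qed
  then obtain p where p: "p \<in> L" "p \<in> smallest_ideal ?R (*)" "ultra_op (*) p p = p"
    by (rule mult.left_ideal_contains_minimal_idempotent)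
  then have pR: "p \<in> ultrafilters ?R" by (simp add: L_def)
  show ?thesis
  proof (intro bexI allI impI conjI)
    show "p \<in> ultrafilters UNIV" using pR ultrafilters_mono[of ?R UNIV] by blast
    fix A assume A: "\<forall>\<^sub>F x in p. x \<in> A"
    then show "central UNIV (+) A" using p(1) by (simp add: L_def)
    have "\<forall>\<^sub>F x in p. x \<in> A - {0}"
      using A pR by (simp add: ultrafilters_def le_principal eventually_conj_iff)
    then show "central ?R (*) (A - {0})" using p(2,3) by (auto simp: central_def)
  qed
qed

end
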